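(* Let $n\ge 1$ and $T=e_1T_1+e_2T_2\in L_1^n\times_eL_1^n$. Let $\Upsilon\subseteq\mathbb{C}_2$ be the set of all modified eigenvalues of $T$, and let $\Upsilon_1,\Upsilon_2\subseteq\mathbb{C}_1$ be the sets of all eigenvalues of $T_1$ and $T_2$, respectively. Then $$\Upsilon=(\Upsilon_1\times_e\mathbb{C}_1)\cup(\mathbb{C}_1\times_e\Upsilon_2).$$
   Context: $\mathbb{C}_1$ denotes the complex numbers with imaginary unit $i_1$. The bicomplex numbers are $\mathbb{C}_2=\{z_1+i_2z_2 : z_1,z_2\in\mathbb{C}_1\}$, a commutative $\mathbb{C}_1$-algebra with $i_1^2=i_2^2=-1$, $i_1i_2=i_2i_1$. Put $e_1=(1+i_1i_2)/2$ and $e_2=(1-i_1i_2)/2$; these are idempotents with $e_1+e_2=1$, $e_1e_2=0$. Every $\xi=z_1+i_2z_2\in\mathbb{C}_2$ is uniquely $\xi=\xi^-e_1+\xi^+e_2$ with $\xi^-=z_1-i_1z_2$, $\xi^+=z_1+i_1z_2\in\mathbb{C}_1$. $\mathbb{C}_2^n$ is regarded as a vector space over $\mathbb{C}_1$; bicomplex scalars act on it componentwise. $L_1^n$ is the set of $\mathbb{C}_1$-linear operators $\mathbb{C}_1^n\to\mathbb{C}_1^n$. For $T_1,T_2\in L_1^n$, $T=e_1T_1+e_2T_2$ is the $\mathbb{C}_1$-linear operator on $\mathbb{C}_2^n$ given by $T(\xi_1,\dots,\xi_n)=e_1T_1(\xi_1^-,\dots,\xi_n^-)+e_2T_2(\xi_1^+,\dots,\xi_n^+)$,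 and $L_1^n\times_eL_1^n$ is the set of all such operators. A scalar $\kappa\in\mathbb{C}_2$ is a modified eigenvalue of $T$ if there is a nonzero $x\in\mathbb{C}_2^n$ with $T(x)=\kappa x$. For $A,B\subseteq\mathbb{C}_1$, the idempotent product is $A\times_eB=\{ae_1+be_2 : a\in A,\ b\in B\}\subseteq\mathbb{C}_2$. *)

theory Defs
  imports "HOL-Analysis.Analysis"
begin

text \<open>The bicomplex number \<open>Bicomplex z w\<close> is $z + i_2 w$; the library type \<open>complex\<close>, with
  imaginary unit \<open>\<i>\<close>, plays the role of $\mathbb{C}_1$.\<close>

datatype bicomplex = Bicomplex (bc_fst: complex) (bc_snd: complex)

instantiation bicomplex :: comm_ring_1
begin

definition "0 = Bicomplex 0 0"
definition "1 = Bicomplex 1 0"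
definition "x + y = Bicomplex (bc_fst x + bc_fst y) (bc_snd x + bc_snd y)"
definition "x - y = Bicomplex (bc_fst x - bc_fst y) (bc_snd x - bc_snd y)"
definition "- x = Bicomplex (- bc_fst x) (- bc_snd x)"
definition "x * y = Bicomplex (bc_fst x * bc_fst y - bc_snd x * bc_snd y)
                              (bc_fst x * bc_snd y + bc_snd x * bc_fst y)"

instance
  by standard
    (simp_all add: zero_bicomplex_def one_bicomplex_def plus_bicomplex_def minus_bicomplex_def
      uminus_bicomplex_def times_bicomplex_def bicomplex.expand algebra_simps)

end

lemmas bicomplex_defs = zero_bicomplex_def one_bicomplex_def plus_bicomplex_def
  minus_bicomplex_def uminus_bicomplex_def times_bicomplex_def

definition of_C1 :: "complex \<Rightarrow> bicomplex" where
  "of_C1 z = Bicomplex z 0"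

definition i1 :: bicomplex where
  "i1 = of_C1 \<i>"

definition i2 :: bicomplex where
  "i2 = Bicomplex 0 1"

definition e1 :: bicomplex where
  "e1 = of_C1 (1/2) * (1 + i1 * i2)"

definition e2 :: bicomplex where
  "e2 = of_C1 (1/2) * (1 - i1 * i2)"

definition minus_part :: "bicomplex \<Rightarrow> complex" where
  "minus_part \<xi> = bc_fst \<xi> - \<i> * bc_snd \<xi>"

definition plus_part :: "bicomplex \<Rightarrow> complex" where
  "plus_part \<xi> = bc_fst \<xi> + \<i> * bc_snd \<xi>"

lemma bicomplex_rep: "\<xi> = of_C1 (bc_fst \<xi>) + i2 * of_C1 (bc_snd \<xi>)"
  by (simp add: of_C1_def i2_def bicomplex_defs bicomplex.expand)

lemma imaginary_units: "i1 * i1 = - 1" "i2 * i2 = - 1"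
  by (simp_all add: of_C1_def i1_def i2_def bicomplex_defs)

lemma idempotents: "e1 * e1 = e1" "e2 * e2 = e2" "e1 * e2 = 0" "e1 + e2 = 1"
  by (simp_all add: e1_def e2_def of_C1_def i1_def i2_def bicomplex_defs)

lemma idempotent_rep_unique:
  "\<xi> = of_C1 a * e1 + of_C1 b * e2 \<longleftrightarrow> a = minus_part \<xi> \<and> b = plus_part \<xi>"
proof -
  have "of_C1 a * e1 + of_C1 b * e2 = Bicomplex ((a + b) / 2) (\<i> * (a - b) / 2)"
    by (simp add: e1_def e2_def of_C1_def i1_def i2_def bicomplex_defs field_simps)
  moreover have "\<xi> = Bicomplex ((a + b) / 2) (\<i> * (a - b) / 2)
      \<longleftrightarrow> a = minus_part \<xi> \<and> b = plus_part \<xi>"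
  proof
    assume "\<xi> = Bicomplex ((a + b) / 2) (\<i> * (a - b) / 2)"
    then show "a = minus_part \<xi> \<and> b = plus_part \<xi>"
      by (simp add: minus_part_def plus_part_def complex_eq_iff field_simps)
  next
    assume "a = minus_part \<xi> \<and> b = plus_part \<xi>"
    then show "\<xi> = Bicomplex ((a + b) / 2) (\<i> * (a - b) / 2)"
      by (cases \<xi>) (simp add: minus_part_def plus_part_def complex_eq_iff)
  qed
  ultimately show ?thesis
    by simp
qed

text \<open>The space $\mathbb{C}_2^n$ is \<open>bicomplex ^ 'n\<close> with $n = $ \<open>CARD('n)\<close>; the operation \<open>*s\<close> on it
  is the componentwise action of bicomplex scalars.\<close>

definition vec_of_C1 :: "complex ^ 'n \<Rightarrow> bicomplex ^ 'n" where
  "vec_of_C1 v = (\<chi> j. of_C1 (v $ j))"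

definition vec_minus_part :: "bicomplex ^ 'n \<Rightarrow> complex ^ 'n" where
  "vec_minus_part x = (\<chi> j. minus_part (x $ j))"

definition vec_plus_part :: "bicomplex ^ 'n \<Rightarrow> complex ^ 'n" where
  "vec_plus_part x = (\<chi> j. plus_part (x $ j))"

text \<open>In \<open>HOL-Analysis\<close> the unqualified \<open>linear\<close> means linearity over the reals, hence the
  explicit scalar multiplications here.\<close>

definition L1 :: "(complex ^ 'n \<Rightarrow> complex ^ 'n) set" where
  "L1 = {S. Vector_Spaces.linear (*s) (*s) S}"

definition idem_op ::
  "(complex ^ 'n \<Rightarrow> complex ^ 'n) \<Rightarrow> (complex ^ 'n \<Rightarrow> complex ^ 'n) \<Rightarrow> bicomplex ^ 'n \<Rightarrow> bicomplex ^ 'n"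
where
  "idem_op T1 T2 x =
     e1 *s vec_of_C1 (T1 (vec_minus_part x)) + e2 *s vec_of_C1 (T2 (vec_plus_part x))"

definition eigenvalues :: "(complex ^ 'n \<Rightarrow> complex ^ 'n) \<Rightarrow> complex set" where
  "eigenvalues S = {c. \<exists>x. x \<noteq> 0 \<and> S x = c *s x}"

definition modified_eigenvalues :: "(bicomplex ^ 'n \<Rightarrow> bicomplex ^ 'n) \<Rightarrow> bicomplex set" where
  "modified_eigenvalues T = {\<kappa>. \<exists>x. x \<noteq> 0 \<and> T x = \<kappa> *s x}"

definition idem_prod :: "complex set \<Rightarrow> complex set \<Rightarrow> bicomplex set"  (infixr "\<times>\<^sub>e" 80) where
  "A \<times>\<^sub>e B = {of_C1 a * e1 + of_C1 b * e2 | a b. a \<in> A \<and> b \<in> B}"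

end

theory Submission
  imports Defs
begin

text \<open>The two idempotent projections \<open>minus_part\<close> and \<open>plus_part\<close> are ring homomorphisms that
  jointly identify the bicomplex numbers with \<open>complex \<times> complex\<close>. Applied in each coordinate they
  turn the single equation \<open>T x = \<kappa> *s x\<close> into the two independent equations
  \<open>T1 u = minus_part \<kappa> *s u\<close> and \<open>T2 v = plus_part \<kappa> *s v\<close>, where \<open>u\<close> and \<open>v\<close> are the two parts
  of \<open>x\<close> (lemma \<open>idem_op_eigen_iff\<close>). The vector \<open>x\<close> is nonzero as soon as one of \<open>u\<close>, \<open>v\<close> is, so
  a modified eigenvector forces only one of the two components of \<open>\<kappa>\<close> to be an eigenvalue.
  Conversely, an eigenvector of one component operator can be paired with the zero vector, which
  solves the other equation for every scalar because a linear operator fixes \<open>0\<close>; this is why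
  the other component of \<open>\<kappa>\<close> is arbitrary.\<close>

lemma parts_of_C1 [simp]:
  "minus_part (of_C1 z) = z" "plus_part (of_C1 z) = z"
  by (simp_all add: minus_part_def plus_part_def of_C1_def)

lemma parts_idempotents [simp]:
  "minus_part e1 = 1" "plus_part e1 = 0" "minus_part e2 = 0" "plus_part e2 = 1"
  by (simp_all add: minus_part_def plus_part_def e1_def e2_def i1_def i2_def of_C1_def
      bicomplex_defs)

lemma parts_zero [simp]: "minus_part 0 = 0" "plus_part 0 = 0"
  by (simp_all add: minus_part_def plus_part_def bicomplex_defs)

lemma parts_add [simp]:
  "minus_part (x + y) = minus_part x + minus_part y"
  "plus_part (x + y) = plus_part x + plus_part y"
  by (simp_all add: minus_part_def plus_part_def bicomplex_defs algebra_simps)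

text \<open>Each projection replaces \<open>i2\<close> by one of the complex square roots \<open>- \<i>\<close> and \<open>\<i>\<close> of \<open>- 1\<close>, which
  respects the defining relation \<open>i2 * i2 = - 1\<close> of the multiplication.\<close>

lemma parts_mult [simp]:
  "minus_part (x * y) = minus_part x * minus_part y"
  "plus_part (x * y) = plus_part x * plus_part y"
  by (simp_all add: minus_part_def plus_part_def bicomplex_defs algebra_simps)

lemma bicomplex_eq_iff_parts:
  "x = y \<longleftrightarrow> minus_part x = minus_part y \<and> plus_part x = plus_part y"
  by (metis idempotent_rep_unique)

lemma vec_eq_iff_parts:
  "x = y \<longleftrightarrow> vec_minus_part x = vec_minus_part y \<and> vec_plus_part x = vec_plus_part y"
  by (auto simp: vec_eq_iff vec_minus_part_def vec_plus_part_def bicomplex_eq_iff_parts)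

lemma vec_parts_zero [simp]: "vec_minus_part 0 = 0" "vec_plus_part 0 = 0"
  by (simp_all add: vec_eq_iff vec_minus_part_def vec_plus_part_def)

lemma vec_parts_scale [simp]:
  "vec_minus_part (\<kappa> *s x) = minus_part \<kappa> *s vec_minus_part x"
  "vec_plus_part (\<kappa> *s x) = plus_part \<kappa> *s vec_plus_part x"
  by (simp_all add: vec_eq_iff vec_minus_part_def vec_plus_part_def)

lemma vec_parts_idempotent_sum [simp]:
  "vec_minus_part (e1 *s vec_of_C1 u + e2 *s vec_of_C1 v) = u"
  "vec_plus_part (e1 *s vec_of_C1 u + e2 *s vec_of_C1 v) = v"
  by (simp_all add: vec_eq_iff vec_minus_part_def vec_plus_part_def vec_of_C1_def)

lemma idem_op_eigen_iff:
  "idem_op T1 T2 x = \<kappa> *s x \<longleftrightarrow>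
     T1 (vec_minus_part x) = minus_part \<kappa> *s vec_minus_part x \<and>
     T2 (vec_plus_part x) = plus_part \<kappa> *s vec_plus_part x"
  unfolding idem_op_def by (subst vec_eq_iff_parts) simp

text \<open>Choosing the two parts of a bicomplex vector independently turns the search for a modified
  eigenvector into the search for a pair of complex vectors, not both zero.\<close>

lemma modified_eigenvalues_idem_op_iff:
  "\<kappa> \<in> modified_eigenvalues (idem_op T1 T2) \<longleftrightarrow>
     (\<exists>u v. (u \<noteq> 0 \<or> v \<noteq> 0) \<and> T1 u = minus_part \<kappa> *s u \<and> T2 v = plus_part \<kappa> *s v)"
  (is "?lhs \<longleftrightarrow> ?rhs")
proof
  assume ?lhs
  then show ?rhs
    by (auto simp: modified_eigenvalues_def idem_op_eigen_iff vec_eq_iff_parts[of _ 0])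
next
  assume ?rhs
  then obtain u v where uv: "u \<noteq> 0 \<or> v \<noteq> 0"
    "T1 u = minus_part \<kappa> *s u" "T2 v = plus_part \<kappa> *s v"
    by blast
  define x where "x = e1 *s vec_of_C1 u + e2 *s vec_of_C1 v"
  have "vec_minus_part x = u" "vec_plus_part x = v"
    by (simp_all add: x_def)
  with uv have "x \<noteq> 0" "idem_op T1 T2 x = \<kappa> *s x"
    by (auto simp: idem_op_eigen_iff)
  then show ?lhs
    by (auto simp: modified_eigenvalues_def)
qed

lemma mem_idem_prod_iff: "\<kappa> \<in> A \<times>\<^sub>e B \<longleftrightarrow> minus_part \<kappa> \<in> A \<and> plus_part \<kappa> \<in> B"
  by (auto simp: idem_prod_def idempotent_rep_unique)

lemma L1_zero: "S \<in> L1 \<Longrightarrow> S 0 = 0"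
  by (simp add: L1_def module_hom.zero linear_iff_module_hom)

theorem theorem3p11:
  fixes T1 T2 :: "complex ^ 'n \<Rightarrow> complex ^ 'n"
    and T :: "bicomplex ^ 'n \<Rightarrow> bicomplex ^ 'n"
  assumes "T1 \<in> L1" and "T2 \<in> L1"
    and "T = idem_op T1 T2"
  shows "modified_eigenvalues T =
    (eigenvalues T1 \<times>\<^sub>e UNIV) \<union> (UNIV \<times>\<^sub>e eigenvalues T2)"
proof (rule set_eqI)
  fix \<kappa>
  \<comment> \<open>The zero vector is a valid partner on either side, whatever the other component of \<open>\<kappa>\<close> is.\<close>
  have "T1 0 = minus_part \<kappa> *s 0" "T2 0 = plus_part \<kappa> *s 0"
    using assms(1,2) by (simp_all add: L1_zero)
  then have "\<kappa> \<in> modified_eigenvalues T \<longleftrightarrow>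
      minus_part \<kappa> \<in> eigenvalues T1 \<or> plus_part \<kappa> \<in> eigenvalues T2"
    unfolding assms(3) modified_eigenvalues_idem_op_iff eigenvalues_def by blast
  then show "\<kappa> \<in> modified_eigenvalues T \<longleftrightarrow>
      \<kappa> \<in> (eigenvalues T1 \<times>\<^sub>e UNIV) \<union> (UNIV \<times>\<^sub>e eigenvalues T2)"
    by (simp add: mem_idem_prod_iff)
qed

end
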